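(* Let $\mu$ be a positive Borel measure on $\mathbb{R}$ with finite moments of all orders, and let $(f,g)_0=\int_{\mathbb{R}} f(t)g(t)\,d\mu(t)$ for $f,g\in\mathcal{P}$. Suppose that $d\mu(t)=t\,d\mu_1(t)$, where $\mu_1$ is a positive measure with finite moments of all orders. Let $[\cdot,\cdot]_1$ be a Geronimus transformation of $(\cdot,\cdot)_0$. Then $[\cdot,\cdot]_1$ admits the representation $$[f,g]_1=\int_{0}^{\infty}f(t)g(t)\,d\mu_1(t)+\left(s_0^*-\int_{0}^{\infty}d\mu_1(t)\right)f(0)g(0),\qquad f,g\in\mathcal{P},$$ for some real number $s_0^*$; moreover $s_0^*$ is arbitrary, i.e. for every $s_0^*\in\mathbb{R}$ the right-hand side defines a Geronimus transformation of $(\cdot,\cdot)_0$.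
   Context: $\mathcal{P}$ is the linear space of polynomials in one variable $t$ with real coefficients. A symmetric bilinear form on $\mathcal{P}$ is a map $B:\mathcal{P}\times\mathcal{P}\to\mathbb{R}$, linear in each argument, with $B(f,g)=B(g,f)$. A Geronimus transformation of $(\cdot,\cdot)_0$ is any symmetric bilinear form $[\cdot,\cdot]_1$ on $\mathcal{P}$ such that $$[tf(t),g(t)]_1=[f(t),tg(t)]_1=(f,g)_0=\int_{\mathbb{R}} f(t)g(t)\,d\mu(t),\qquad f,g\in\mathcal{P}.$$ (This condition does not determine $[\cdot,\cdot]_1$ uniquely.) Since $\mu$ and $\mu_1$ are positive and $d\mu=t\,d\mu_1$, the measures are supported on $[0,\infty)$; the integrals $\int_0^\infty$ are over the closed half-line $[0,\infty)$, including a possible atom of $\mu_1$ at $0$. *)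

theory Defs
  imports "HOL-Analysis.Analysis" "HOL-Computational_Algebra.Polynomial"
begin

definition symmetric_bilinear_form :: "(real poly \<Rightarrow> real poly \<Rightarrow> real) \<Rightarrow> bool" where
  "symmetric_bilinear_form B \<longleftrightarrow>
     (\<forall>g. Vector_Spaces.linear smult (*) (\<lambda>f. B f g)) \<and>
     (\<forall>f. Vector_Spaces.linear smult (*) (\<lambda>g. B f g)) \<and>
     (\<forall>f g. B f g = B g f)"

text \<open>The case \<open>n = 0\<close> of the moment condition makes the measure finite.\<close>

definition borel_measure_with_moments :: "real measure \<Rightarrow> bool" where
  "borel_measure_with_moments \<mu> \<longleftrightarrow>
     sets \<mu> = sets borel \<and> (\<forall>n::nat. integrable \<mu> (\<lambda>t. t ^ n))"

definition moment_form :: "real measure \<Rightarrow> real poly \<Rightarrow> real poly \<Rightarrow> real" where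
  "moment_form \<mu> f g = (LINT t|\<mu>. poly f t * poly g t)"

text \<open>
  The relation \<open>d\<mu>(t) = t d\<mu>\<^sub>1(t)\<close>, with the signed weight \<open>t\<close>. The library's
  \<^const>\<open>density\<close> takes an extended nonnegative weight, so
  \<open>density \<mu>\<^sub>1 (\<lambda>t. ennreal t)\<close> would silently truncate \<open>t\<close> to \<open>0\<close> on the negative
  half-line. Here, for measures with finite moments, positivity of \<open>\<mu>\<close> forces
  \<open>\<mu>\<^sub>1 {..<0} = 0\<close>.
\<close>

definition is_t_times :: "real measure \<Rightarrow> real measure \<Rightarrow> bool" where
  "is_t_times \<mu> \<mu>\<^sub>1 \<longleftrightarrow>
     (\<forall>A\<in>sets borel. measure \<mu> A = (LINT t:A|\<mu>\<^sub>1. t))"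

text \<open>The polynomial \<open>[:0, 1:]\<close> is the variable \<open>t\<close>.\<close>

definition geronimus_transformation ::
    "(real poly \<Rightarrow> real poly \<Rightarrow> real) \<Rightarrow> (real poly \<Rightarrow> real poly \<Rightarrow> real) \<Rightarrow> bool" where
  "geronimus_transformation B\<^sub>0 B\<^sub>1 \<longleftrightarrow>
     symmetric_bilinear_form B\<^sub>1 \<and>
     (\<forall>f g. B\<^sub>1 ([:0, 1:] * f) g = B\<^sub>0 f g \<and> B\<^sub>1 f ([:0, 1:] * g) = B\<^sub>0 f g)"

end

theory Submission
  imports Defs
begin

text \<open>
  A Geronimus transformation \<open>B\<close> is pinned down on \<open>t\<P> \<times> \<P>\<close> and on \<open>\<P> \<times> t\<P>\<close>. Splitting off
  constant terms, \<open>f = f(0) + t f\<^sub>1\<close> and \<open>g = g(0) + t g\<^sub>1\<close>, leaves \<open>B 1 1\<close> as its only free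
  parameter (\<open>geronimus_transformation_unique\<close>). So a one-parameter family of Geronimus
  transformations in which \<open>B 1 1\<close> takes every real value exhausts all of them, and the asserted
  representation is such a family: its value at \<open>(1, 1)\<close> is \<open>s\<close>, the mass of \<open>\<mu>\<^sub>1\<close> on the half-line
  cancelling out.

  That every member of the family is a Geronimus transformation is an integral identity: the
  point-mass term vanishes as soon as one factor is divisible by \<open>t\<close>, and what remains is
  \<open>\<integral> t f g d\<mu>\<^sub>1\<close> over the half-line, to be compared with \<open>\<integral> f g d\<mu>\<close>. The analytic content is that
  positivity of \<open>\<mu>\<close> leaves \<open>\<mu>\<^sub>1\<close> no mass on the negative half-line (\<open>is_t_times_AE_nonneg\<close>), which
  turns the setwise relation between the measures into an honest nonnegative density
  (\<open>is_t_times_imp_density\<close>).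
\<close>

lemma moments_integrable_poly:
  assumes "borel_measure_with_moments M"
  shows "integrable M (poly p)"
proof -
  have "integrable M (\<lambda>t. \<Sum>i\<le>degree p. coeff p i * t ^ i)"
    using assms by (intro Bochner_Integration.integrable_sum integrable_mult_right)
      (auto simp: borel_measure_with_moments_def)
  moreover have "poly p = (\<lambda>t. \<Sum>i\<le>degree p. coeff p i * t ^ i)"
    by (rule ext) (rule poly_altdef)
  ultimately show ?thesis by simp
qed

lemma moments_set_integrable_poly:
  assumes "borel_measure_with_moments M"
  shows "set_integrable M {0..} (poly p)"
proof -
  have "set_integrable M UNIV (poly p)"
    using moments_integrable_poly[OF assms] by (simp add: set_integrable_def)
  then show ?thesis
    by (rule set_integrable_subset) (use assms in \<open>auto simp: borel_measure_with_moments_def\<close>)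
qed

lemma moments_finite_measure:
  assumes "borel_measure_with_moments M"
  shows "finite_measure M"
proof -
  have "integrable M (\<lambda>t. t ^ 0)"
    using assms unfolding borel_measure_with_moments_def by blast
  then have "integrable M (\<lambda>t. 1 :: real)" by simp
  then have "emeasure M (space M) < \<infinity>"
    by (simp add: integrable_iff_bounded)
  then show ?thesis by (intro finite_measureI) simp
qed

text \<open>
  Tested on the negative half-line, \<open>d\<mu> = t d\<mu>\<^sub>1\<close> equates the nonnegative number
  \<open>\<mu> {..<0}\<close> with the integral of a nonpositive function. The latter therefore vanishes
  almost everywhere.
\<close>

lemma is_t_times_AE_nonneg:
  assumes m1: "borel_measure_with_moments \<mu>\<^sub>1"
    and t: "is_t_times \<mu> \<mu>\<^sub>1"
  shows "AE t in \<mu>\<^sub>1. 0 \<le> t"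
proof -
  define h where "h t = indicator {..<0} t * (- t)" for t :: real
  have sets: "sets \<mu>\<^sub>1 = sets borel"
    using m1 by (simp add: borel_measure_with_moments_def)
  have h_nonneg: "0 \<le> h t" for t
    by (simp add: h_def indicator_def)
  have "integrable \<mu>\<^sub>1 (\<lambda>t::real. t ^ 1)"
    using m1 unfolding borel_measure_with_moments_def by blast
  then have int: "integrable \<mu>\<^sub>1 h"
    using integrable_real_mult_indicator[of "{..<0}" \<mu>\<^sub>1 "\<lambda>t. - t"]
    by (simp add: h_def[abs_def] sets mult.commute)
  have "0 \<le> measure \<mu> {..<0}" by simp
  also have "\<dots> = (LINT t:{..<0}|\<mu>\<^sub>1. t)"
    using t by (simp add: is_t_times_def)
  also have "\<dots> = - integral\<^sup>L \<mu>\<^sub>1 h"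
    by (simp add: set_lebesgue_integral_def h_def[abs_def])
  finally have "integral\<^sup>L \<mu>\<^sub>1 h = 0"
    using Bochner_Integration.integral_nonneg[of \<mu>\<^sub>1 h] h_nonneg by fastforce
  then have "AE t in \<mu>\<^sub>1. h t = 0"
    using integral_nonneg_eq_0_iff_AE[OF int] h_nonneg by auto
  then show ?thesis
    by eventually_elim (auto simp: h_def indicator_def split: if_splits)
qed

text \<open>
  The weight \<open>t\<close> is nonnegative almost everywhere, so its truncation to extended nonnegative
  reals changes no integral against \<open>\<mu>\<^sub>1\<close>. Finiteness of \<open>\<mu>\<close> lets the equality of real-valued
  measures be lifted to extended-valued ones.
\<close>

lemma is_t_times_imp_density:
  assumes m: "borel_measure_with_moments \<mu>"
    and m1: "borel_measure_with_moments \<mu>\<^sub>1"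
    and t: "is_t_times \<mu> \<mu>\<^sub>1"
  shows "\<mu> = density \<mu>\<^sub>1 (\<lambda>t. ennreal t)"
proof (rule measure_eqI)
  have sets: "sets \<mu> = sets borel" and sets1: "sets \<mu>\<^sub>1 = sets borel"
    using m m1 by (simp_all add: borel_measure_with_moments_def)
  show "sets \<mu> = sets (density \<mu>\<^sub>1 (\<lambda>t. ennreal t))"
    by (simp add: sets sets1)
  have meas1: "measurable \<mu>\<^sub>1 borel = measurable borel (borel :: 'b::topological_space measure)"
    by (rule measurable_cong_sets) (simp_all add: sets1)
  have "poly [:0, 1:] = (\<lambda>t::real. t)" by (simp add: fun_eq_iff)
  then have int: "integrable \<mu>\<^sub>1 (\<lambda>t. t)"
    using moments_integrable_poly[OF m1, of "[:0, 1:]"] by simp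
  fix A assume "A \<in> sets \<mu>"
  then have A: "A \<in> sets borel" by (simp add: sets)
  have "emeasure \<mu> A = ennreal (measure \<mu> A)"
    by (rule finite_measure.emeasure_eq_measure[OF moments_finite_measure[OF m]])
  also have "measure \<mu> A = (LINT t|\<mu>\<^sub>1. t * indicator A t)"
    using t A by (simp add: is_t_times_def set_lebesgue_integral_def mult.commute)
  also have "ennreal \<dots> = (\<integral>\<^sup>+t. ennreal (t * indicator A t) \<partial>\<mu>\<^sub>1)"
  proof (rule nn_integral_eq_integral[symmetric])
    show "integrable \<mu>\<^sub>1 (\<lambda>t. t * indicator A t)"
      using int A by (intro integrable_real_mult_indicator) (simp_all add: sets1)
    show "AE t in \<mu>\<^sub>1. 0 \<le> t * indicator A t"
      using is_t_times_AE_nonneg[OF m1 t] by eventually_elim simp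
  qed
  also have "\<dots> = (\<integral>\<^sup>+t. ennreal t * indicator A t \<partial>\<mu>\<^sub>1)"
    by (intro nn_integral_cong) (simp add: indicator_def)
  also have "\<dots> = emeasure (density \<mu>\<^sub>1 (\<lambda>t. ennreal t)) A"
    using A by (intro emeasure_density[symmetric]) (auto simp: sets1 meas1)
  finally show "emeasure \<mu> A = emeasure (density \<mu>\<^sub>1 (\<lambda>t. ennreal t)) A" .
qed

lemma moment_form_eq_half_line_integral:
  assumes m: "borel_measure_with_moments \<mu>"
    and m1: "borel_measure_with_moments \<mu>\<^sub>1"
    and t: "is_t_times \<mu> \<mu>\<^sub>1"
  shows "moment_form \<mu> f g = (LINT t:{0..}|\<mu>\<^sub>1. t * (poly f t * poly g t))"
proof -
  have nonneg: "AE t in \<mu>\<^sub>1. 0 \<le> t" by (rule is_t_times_AE_nonneg[OF m1 t])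
  have sets1: "sets \<mu>\<^sub>1 = sets borel"
    using m1 by (simp add: borel_measure_with_moments_def)
  have meas1: "measurable \<mu>\<^sub>1 borel = measurable borel (borel :: real measure)"
    by (rule measurable_cong_sets) (simp_all add: sets1)
  have poly_meas: "poly p \<in> borel_measurable \<mu>\<^sub>1" for p
    using moments_integrable_poly[OF m1] by blast
  have "moment_form \<mu> f g = (LINT t|density \<mu>\<^sub>1 (\<lambda>t. ennreal t). poly f t * poly g t)"
    unfolding moment_form_def by (subst is_t_times_imp_density[OF m m1 t]) (rule refl)
  also have "\<dots> = (LINT t|\<mu>\<^sub>1. t *\<^sub>R (poly f t * poly g t))"
    by (intro integral_density borel_measurable_times poly_meas nonneg) (simp add: meas1)
  also have "\<dots> = (LINT t:{0..}|\<mu>\<^sub>1. t * (poly f t * poly g t))"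
    unfolding set_lebesgue_integral_def
  proof (rule integral_cong_AE)
    show meas: "(\<lambda>t. t *\<^sub>R (poly f t * poly g t)) \<in> borel_measurable \<mu>\<^sub>1"
      by (intro borel_measurable_scaleR borel_measurable_times poly_meas) (simp add: meas1)
    show "(\<lambda>t. indicat_real {0..} t *\<^sub>R (t * (poly f t * poly g t))) \<in> borel_measurable \<mu>\<^sub>1"
      by (intro borel_measurable_scaleR borel_measurable_indicator meas[unfolded real_scaleR_def])
        (simp add: sets1)
    show "AE t in \<mu>\<^sub>1. t *\<^sub>R (poly f t * poly g t)
        = indicat_real {0..} t *\<^sub>R (t * (poly f t * poly g t))"
      using nonneg by eventually_elim simp
  qed
  finally show ?thesis .
qed

lemma symmetric_bilinear_formI:
  assumes sym: "\<And>f g. B f g = B g f"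
    and add: "\<And>f h g. B (f + h) g = B f g + B h g"
    and smult: "\<And>c f g. B (smult c f) g = c * B f g"
  shows "symmetric_bilinear_form B"
proof -
  have "vector_space (smult :: real \<Rightarrow> real poly \<Rightarrow> real poly)"
    by unfold_locales (simp_all add: smult_add_right smult_add_left)
  moreover have "vector_space ((*) :: real \<Rightarrow> real \<Rightarrow> real)"
    by unfold_locales (simp_all add: algebra_simps)
  ultimately have left: "Vector_Spaces.linear smult (*) (\<lambda>f. B f g)" for g
    by (simp add: Vector_Spaces.linear_iff add smult)
  have "(\<lambda>g. B f g) = (\<lambda>g. B g f)" for f
    by (rule ext) (rule sym)
  then have "Vector_Spaces.linear smult (*) (\<lambda>g. B f g)" for f
    using left[of f] by metis
  with left sym show ?thesis
    unfolding symmetric_bilinear_form_def by blast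
qed

text \<open>
  Since all polynomials are integrable over the half-line, bilinearity is linearity of the
  integral. Multiplication of one factor by \<open>t\<close> kills the point mass
  and puts the weight \<open>t\<close> under the integral.
\<close>

lemma geronimus_transformation_half_line:
  assumes m: "borel_measure_with_moments \<mu>"
    and m1: "borel_measure_with_moments \<mu>\<^sub>1"
    and t: "is_t_times \<mu> \<mu>\<^sub>1"
  shows "geronimus_transformation (moment_form \<mu>)
    (\<lambda>f g. (LINT t:{0..}|\<mu>\<^sub>1. poly f t * poly g t) + c * poly f 0 * poly g 0)"
    (is "geronimus_transformation _ ?R")
proof -
  have int: "set_integrable \<mu>\<^sub>1 {0..} (\<lambda>t. poly f t * poly g t)" for f g
    using moments_set_integrable_poly[OF m1, of "f * g"] by (simp add: poly_mult[abs_def])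
  have "symmetric_bilinear_form ?R"
  proof (rule symmetric_bilinear_formI)
    show "?R f g = ?R g f" for f g
      by (simp add: mult_ac)
    show "?R (f + h) g = ?R f g + ?R h g" for f h g
      by (simp add: distrib_left distrib_right set_integral_add(2)[OF int int])
    show "?R (smult a f) g = a * ?R f g" for a f g
      by (simp add: distrib_left mult.assoc mult.left_commute)
  qed
  moreover have "?R ([:0, 1:] * f) g = moment_form \<mu> f g"
    and "?R f ([:0, 1:] * g) = moment_form \<mu> f g" for f g
    by (simp_all add: moment_form_eq_half_line_integral[OF m m1 t] mult_ac)
  ultimately show ?thesis
    unfolding geronimus_transformation_def by blast
qed

text \<open>
  Expanding both arguments around their constant terms gives
  \<open>B f g = f(0) g(0) B 1 1 + f(0) (1, g\<^sub>1)\<^sub>0 + (f\<^sub>1, g)\<^sub>0\<close>, in which only \<open>B 1 1\<close> depends on \<open>B\<close>.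
\<close>

lemma geronimus_transformation_unique:
  assumes B: "geronimus_transformation B\<^sub>0 B"
    and C: "geronimus_transformation B\<^sub>0 C"
    and eq: "B 1 1 = C 1 1"
  shows "B = C"
proof -
  have expand: "D (pCons a p) (pCons b q) = a * (b * D 1 1 + B\<^sub>0 1 q) + B\<^sub>0 p (pCons b q)"
    if D: "geronimus_transformation B\<^sub>0 D" for D a b p q
  proof -
    have split: "pCons c r = smult c 1 + [:0, 1:] * r" for c :: real and r
      by (simp add: one_pCons)
    have left: "Vector_Spaces.linear smult (*) (\<lambda>f. D f g)"
      and right: "Vector_Spaces.linear smult (*) (\<lambda>g. D f g)"
      and tl: "D ([:0, 1:] * f) g = B\<^sub>0 f g" and tr: "D f ([:0, 1:] * g) = B\<^sub>0 f g" for f g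
      using D unfolding geronimus_transformation_def symmetric_bilinear_form_def by blast+
    have "D (pCons a p) g = a * D 1 g + B\<^sub>0 p g" for g
      unfolding split[of a p] using left[of g] tl[of p g]
      by (simp only: Vector_Spaces.linear_iff)
    moreover have "D 1 (pCons b q) = b * D 1 1 + B\<^sub>0 1 q"
      unfolding split[of b q] using right[of 1] tr[of 1 q]
      by (simp only: Vector_Spaces.linear_iff)
    ultimately show ?thesis by simp
  qed
  show ?thesis
  proof (intro ext)
    fix f g show "B f g = C f g"
      by (cases f, cases g) (simp add: expand[OF B] expand[OF C] eq)
  qed
qed

theorem proposition2p2:
  fixes \<mu> \<mu>\<^sub>1 :: "real measure"
  assumes "borel_measure_with_moments \<mu>"
    and "borel_measure_with_moments \<mu>\<^sub>1"
    and "is_t_times \<mu> \<mu>\<^sub>1"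
  shows
    "(\<forall>B. geronimus_transformation (moment_form \<mu>) B \<longrightarrow>
        (\<exists>s::real. \<forall>f g.
          B f g = (LINT t:{0..}|\<mu>\<^sub>1. poly f t * poly g t)
                  + (s - (LINT t:{0..}|\<mu>\<^sub>1. 1)) * poly f 0 * poly g 0)) \<and>
     (\<forall>s::real. geronimus_transformation (moment_form \<mu>)
        (\<lambda>f g. (LINT t:{0..}|\<mu>\<^sub>1. poly f t * poly g t)
               + (s - (LINT t:{0..}|\<mu>\<^sub>1. 1)) * poly f 0 * poly g 0))"
proof -
  define R where "R s = (\<lambda>f g. (LINT t:{0..}|\<mu>\<^sub>1. poly f t * poly g t)
    + (s - (LINT t:{0..}|\<mu>\<^sub>1. 1)) * poly f 0 * poly g 0)" for s
  have R: "geronimus_transformation (moment_form \<mu>) (R s)" for s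
    unfolding R_def by (rule geronimus_transformation_half_line[OF assms])
  have "B = R (B 1 1)" if "geronimus_transformation (moment_form \<mu>) B" for B
    by (rule geronimus_transformation_unique[OF that R]) (simp add: R_def poly_1[abs_def])
  then have "\<exists>s. \<forall>f g. B f g = R s f g" if "geronimus_transformation (moment_form \<mu>) B" for B
    using that by metis
  with R show ?thesis
    unfolding R_def by blast
qed

end
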